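(* Let $AF=(A,\mathcal R)$ be an abstract argumentation framework with $A$ finite and let $\mathcal L_c$ be a complete labelling of $AF$. Then there exists a sequence $\varsigma$ such that, with $\chi=(\varsigma,\kappa)$ where $\kappa$ is the modified ("last enunciated last updated") argumentative context of $AF$, the associated labelling $\mathcal L_t$ of the final argumentative state $S^\chi(t)$ of the path valid with respect to $\chi$ satisfies $\mathcal L_t=\mathcal L_c$.
   Context: **Fluents and states.** $A$ is a finite set of arguments and $\mathcal R\subseteq A\times A$ the attack relation. Fluents $\mathbb F$: $p_x$ ($x$ is present), $i_x$ (in), $o_x$ (out), $l_x$ ($x$ is to be updated last) for $x\in A$, and $cA_{y,x}$ ($y$ can attack $x$) for $x,y\in A$. $Lit_{\mathbb F}=\mathbb F\cup\{\neg f: f\in\mathbb F\}$, and $\overline{l}$ denotes the complement of a literal $l$. A state is a set of literals containing exactly one of $f,\neg f$ for every $f\in\mathbb F$; $S\models\psi$ is propositional satisfaction. **Events of the modified context.** $\mathbb E=\mathbb A\cup\mathbb U$ (disjoint). Actions: $\mathbb A=\{enunciate_x: x\in A\}$, $pre(enunciate_x)=\top$, $\mathrm{eff}(enunciate_x)=\{p_x,l_x,i_x,\neg o_x\}$. Exogenous events $\mathbb U=\mathbb U^f\cup\mathbb U^l$, with $\mathbb U^f=\{\Delta^{1f}_{y,x},\Delta^{2f}_{y,x},I^{1f}_x,I^{2f}_x\}$ and $\mathbb U^l=\{\Delta^{1l}_{y,x},\Delta^{2l}_{y,x},I^{1l}_x,I^{2l}_x\}$ ($x,y\in A$). Consider the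 base conditions and effects - $\Delta^1_{y,x}$: condition $p_x\wedge i_x\wedge p_y\wedge cA_{y,x}\wedge\neg o_y$, effect $\neg i_x$; - $\Delta^2_{y,x}$: condition $p_x\wedge\neg o_x\wedge p_y\wedge cA_{y,x}\wedge i_y$, effect $o_x$; - $I^1_x$: condition $p_x\wedge o_x\wedge\bigwedge_{y\in A}((cA_{y,x}\wedge\neg i_y)\vee\neg cA_{y,x})$, effect $\neg o_x$; - $I^2_x$: condition $p_x\wedge\neg i_x\wedge\bigwedge_{y\in A}((cA_{y,x}\wedge o_y)\vee\neg cA_{y,x})$, effect $i_x$. The $f$-version of each has $tri$ = base condition $\wedge\,\neg l_x$ and the base effect; the $l$-version has $tri$ = base condition $\wedge\, l_x$ and effects the base effect together with $\neg l_x$. For exogenous events $pre=tri$. **Priorities.** The strict partial order $\succ$ consists exactly of: for each $v\in\{f,l\}$, $I^{1v}_x\succ I^{2v}_x$ for all $x$, and $I^{1v}_{x_1}\succ\Delta^{2v}_{y_2,x_2}$, $\Delta^{1v}_{y_1,x_1}\succ\Delta^{2v}_{y_2,x_2}$ for all $x_1,y_1,x_2,y_2\in A$; and $e\succ e'$ for all $e\in\mathbb U^f$, $e'\in\mathbb U^l$. **Initial state** $S_0$: for all $x$, $\neg p_x,\neg i_x,o_x,\neg l_x$; $cA_{y,x}$ holds iff $(y,x)\in\mathcal R$. The modified context $\kappa$ consists of all the data above together with a time domain $\mathbb T=\{0,\dots,N\}$. **Valid paths.** A path $S(0),E(0),S(1),\dots,E(N),S(N+1)$ is valid w.r.t. $\kappa$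 if $S(0)=S_0$ and for each $t\in\{0,\dots,N\}$: (1) $S(t)$ is a state; (2.a) $S(t)\models pre(e)$ for all $e\in E(t)\subseteq\mathbb E$; (2.b) no $e,e'\in E(t)$ with $e\succ e'$; (2.c) for each $e\in\mathbb U$ with $S(t)\models tri(e)$, either $e\in E(t)$ or some $e'\in E(t)$ has $e'\succ e$; (2.d) if $E(t)\cap\mathbb A\neq\emptyset$ then $S(t)\not\models tri(e')$ for all $e'\in\mathbb U$; (2.e) $E(t)\ne\emptyset$; (3) $S(t+1)=\{l\in S(t):\forall e\in E(t),\ \overline{l}\notin\mathrm{eff}(e)\}\cup\{l\in Lit_{\mathbb F}:\exists e\in E(t),\ l\in\mathrm{eff}(e)\}$. **Sequences.** A sequence is a finite set $\varsigma\subseteq\mathbb A\times\mathbb N$ of ranked actions (the same action may occur with several ranks, i.e. an argument may be repeated; several actions may share a rank). The path valid w.r.t. $\chi=(\varsigma,\kappa)$ is the path valid w.r.t. $\kappa$ in which the actions of $\varsigma$ are performed in order of increasing rank, actions of equal rank being performed simultaneously, actions of different ranks at different times, each ranked action being performed exactly once and no other action being performed. The horizon $N$ is such that all ranked actions have been performed and no exogenous event is triggered in $S(N+1)$; the final state is $S^\chi(t)$ with $t=N+1$. **Argumentative state.** A state $S$ is ($\Sigma_c$-)argumentative if for every $x\in A$: (i) $S\models p_x\wedge i_x\wedge\neg o_x$ iff $S\models p_x\wedge\bigwedge_{y\in A}((cA_{y,x}\wedge\neg i_y\wedge o_y)\vee\neg cA_{y,x})$; (ii) $S\models p_x\wedge\neg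 i_x\wedge o_x$ iff there is $y\in A$ with $S\models p_x\wedge p_y\wedge cA_{y,x}\wedge i_y\wedge\neg o_y$. **Labellings.** The associated labelling $\mathcal L_t$ of $S^\chi(t)$ is defined on $\{x\in A: S^\chi(t)\models p_x\}$: $x$ is IN if $i_x\wedge\neg o_x$ holds, OUT if $\neg i_x\wedge o_x$ holds, UNDEC if $\neg i_x\wedge\neg o_x$ holds; so $\mathcal L_t=\mathcal L_c$ includes that all arguments of $A$ are present. A labelling $\mathcal L: A\to\{\mathrm{IN},\mathrm{OUT},\mathrm{UNDEC}\}$ is complete iff for every $x$: $\mathcal L(x)=\mathrm{IN}$ iff all attackers $y$ of $x$ (i.e. $(y,x)\in\mathcal R$) have $\mathcal L(y)=\mathrm{OUT}$; and $\mathcal L(x)=\mathrm{OUT}$ iff some attacker $y$ of $x$ has $\mathcal L(y)=\mathrm{IN}$. *)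

theory Defs
  imports Main
begin

section \<open>Fluents, literals, formulas\<close>

datatype 'a fluent =
    Present 'a
  | In 'a
  | Out 'a
  | Last 'a
  | CanAttack 'a 'a  \<comment> \<open>\<open>CanAttack y x\<close>: \<open>y\<close> can attack \<open>x\<close>\<close>

datatype 'a literal = Pos "'a fluent" | Neg "'a fluent"

fun complement :: "'a literal \<Rightarrow> 'a literal" where
  "complement (Pos f) = Neg f"
| "complement (Neg f) = Pos f"

definition fluents :: "'a set \<Rightarrow> 'a fluent set" where
  "fluents A = Present ` A \<union> In ` A \<union> Out ` A \<union> Last ` A \<union> {CanAttack y x | y x. y \<in> A \<and> x \<in> A}"

definition literals :: "'a fluent set \<Rightarrow> 'a literal set" where
  "literals F = Pos ` F \<union> Neg ` F"

type_synonym 'a state = "'a literal set"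

definition is_state :: "'a fluent set \<Rightarrow> 'a state \<Rightarrow> bool" where
  "is_state F S \<longleftrightarrow> S \<subseteq> literals F \<and> (\<forall>f\<in>F. Pos f \<in> S \<longleftrightarrow> Neg f \<notin> S)"

text \<open>\<open>BigAnd A \<phi>\<close> is the conjunction of the formulas \<open>\<phi> y\<close> for \<open>y \<in> A\<close>; it is used only with
  the finite set of arguments.\<close>

datatype 'a formula =
    Top                             ("\<^bold>\<top>")
  | Atom "'a fluent"
  | FNot "'a formula"               ("\<^bold>\<not> _" [40] 40)
  | FAnd "'a formula" "'a formula"  (infixr "\<^bold>\<and>" 35)
  | FOr "'a formula" "'a formula"   (infixr "\<^bold>\<or>" 30)
  | BigAnd "'a set" "'a \<Rightarrow> 'a formula"

primrec sat :: "'a state \<Rightarrow> 'a formula \<Rightarrow> bool"  (infix "\<Turnstile>" 25) where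
  "(S \<Turnstile> \<^bold>\<top>) \<longleftrightarrow> True"
| "(S \<Turnstile> Atom f) \<longleftrightarrow> Pos f \<in> S"
| "(S \<Turnstile> \<^bold>\<not> \<phi>) \<longleftrightarrow> \<not> (S \<Turnstile> \<phi>)"
| "(S \<Turnstile> \<phi> \<^bold>\<and> \<psi>) \<longleftrightarrow> (S \<Turnstile> \<phi>) \<and> (S \<Turnstile> \<psi>)"
| "(S \<Turnstile> \<phi> \<^bold>\<or> \<psi>) \<longleftrightarrow> (S \<Turnstile> \<phi>) \<or> (S \<Turnstile> \<psi>)"
| "(S \<Turnstile> BigAnd A \<phi>) \<longleftrightarrow> (\<forall>y\<in>A. S \<Turnstile> \<phi> y)"

abbreviation p :: "'a \<Rightarrow> 'a formula" where "p x \<equiv> Atom (Present x)"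
abbreviation i :: "'a \<Rightarrow> 'a formula" where "i x \<equiv> Atom (In x)"
abbreviation o' :: "'a \<Rightarrow> 'a formula" where "o' x \<equiv> Atom (Out x)"
abbreviation l :: "'a \<Rightarrow> 'a formula" where "l x \<equiv> Atom (Last x)"
abbreviation cA :: "'a \<Rightarrow> 'a \<Rightarrow> 'a formula" where "cA y x \<equiv> Atom (CanAttack y x)"


section \<open>Contexts and valid paths\<close>

datatype version = Vf | Vl

datatype 'a base_event =
    Delta1 'a 'a  \<comment> \<open>\<open>Delta1 y x\<close>: attacker \<open>y\<close> first, target \<open>x\<close> second\<close>
  | Delta2 'a 'a
  | I1 'a
  | I2 'a

datatype 'a event = Enunciate 'a | Exo version "'a base_event"

record 'a arg_context =
  Fluents :: "'a fluent set"
  Init :: "'a state"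
  Actions :: "'a event set"
  Exogenous :: "'a event set"
  Pre :: "'a event \<Rightarrow> 'a formula"
  Tri :: "'a event \<Rightarrow> 'a formula"  \<comment> \<open>only relevant on exogenous events\<close>
  Eff :: "'a event \<Rightarrow> 'a literal set"
  Prio :: "('a event \<times> 'a event) set"  \<comment> \<open>\<open>(e, e') \<in> Prio\<close> means \<open>e \<succ> e'\<close>\<close>

definition successor :: "'a arg_context \<Rightarrow> 'a state \<Rightarrow> 'a event set \<Rightarrow> 'a state" where
  "successor \<kappa> S E =
     {k \<in> S. \<forall>e\<in>E. complement k \<notin> Eff \<kappa> e} \<union>
     {k \<in> literals (Fluents \<kappa>). \<exists>e\<in>E. k \<in> Eff \<kappa> e}"

text \<open>A path \<open>S(0), E(0), S(1), \<dots>, E(N), S(N+1)\<close> is the pair of the lists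
  \<open>Ss = [S(0), \<dots>, S(N+1)]\<close> and \<open>Es = [E(0), \<dots>, E(N)]\<close>. The time domain \<open>{0, \<dots>, N}\<close> of the
  context is thus \<open>{..<length Es}\<close>. The list \<open>Es\<close> may be empty (no time point, i.e. \<open>N = -1\<close>):
  since every \<open>E(t)\<close> must be nonempty, this is the only path for a framework without arguments.\<close>

type_synonym 'a path = "'a state list \<times> 'a event set list"

definition valid_path :: "'a arg_context \<Rightarrow> 'a path \<Rightarrow> bool" where
  "valid_path \<kappa> = (\<lambda>(Ss, Es).
     length Ss = Suc (length Es) \<and>
     Ss ! 0 = Init \<kappa> \<and>
     (\<forall>t<length Es.
        is_state (Fluents \<kappa>) (Ss ! t) \<and>
        Es ! t \<subseteq> Actions \<kappa> \<union> Exogenous \<kappa> \<and>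
        (\<forall>e\<in>Es ! t. Ss ! t \<Turnstile> Pre \<kappa> e) \<and>
        (\<forall>e\<in>Es ! t. \<forall>e'\<in>Es ! t. (e, e') \<notin> Prio \<kappa>) \<and>
        (\<forall>e\<in>Exogenous \<kappa>. (Ss ! t \<Turnstile> Tri \<kappa> e) \<longrightarrow> e \<in> Es ! t \<or> (\<exists>e'\<in>Es ! t. (e', e) \<in> Prio \<kappa>)) \<and>
        (Es ! t \<inter> Actions \<kappa> \<noteq> {} \<longrightarrow> (\<forall>e'\<in>Exogenous \<kappa>. \<not> (Ss ! t \<Turnstile> Tri \<kappa> e'))) \<and>
        Es ! t \<noteq> {} \<and>
        Ss ! Suc t = successor \<kappa> (Ss ! t) (Es ! t)))"

definition action_sequence :: "'a arg_context \<Rightarrow> ('a event \<times> nat) set \<Rightarrow> bool" where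
  "action_sequence \<kappa> \<sigma> \<longleftrightarrow> finite \<sigma> \<and> \<sigma> \<subseteq> Actions \<kappa> \<times> UNIV"

text \<open>\<open>\<tau>\<close> maps each occurring rank to the time at which exactly the actions of that rank are
  performed.\<close>

definition performs :: "'a arg_context \<Rightarrow> ('a event \<times> nat) set \<Rightarrow> 'a event set list \<Rightarrow> bool" where
  "performs \<kappa> \<sigma> Es \<longleftrightarrow>
     (\<exists>\<tau> :: nat \<Rightarrow> nat.
        strict_mono_on (snd ` \<sigma>) \<tau> \<and>
        (\<forall>r\<in>snd ` \<sigma>. \<tau> r < length Es) \<and>
        (\<forall>t<length Es. Es ! t \<inter> Actions \<kappa> = {a. \<exists>r. (a, r) \<in> \<sigma> \<and> \<tau> r = t}))"

text \<open>Validity with respect to \<open>\<chi> = (\<sigma>, \<kappa>)\<close>; the last conjunct, together with \<open>performs\<close>, is the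
  condition on the horizon.\<close>

definition valid_path_wrt :: "('a event \<times> nat) set \<times> 'a arg_context \<Rightarrow> 'a path \<Rightarrow> bool" where
  "valid_path_wrt = (\<lambda>(\<sigma>, \<kappa>) (Ss, Es).
     valid_path \<kappa> (Ss, Es) \<and> performs \<kappa> \<sigma> Es \<and>
     (\<forall>e\<in>Exogenous \<kappa>. \<not> (last Ss \<Turnstile> Tri \<kappa> e)))"


section \<open>The modified argumentative context\<close>

fun base_cond :: "'a set \<Rightarrow> 'a base_event \<Rightarrow> 'a formula" where
  "base_cond A (Delta1 y x) = (p x \<^bold>\<and> i x \<^bold>\<and> p y \<^bold>\<and> cA y x \<^bold>\<and> \<^bold>\<not> o' y)"
| "base_cond A (Delta2 y x) = (p x \<^bold>\<and> \<^bold>\<not> o' x \<^bold>\<and> p y \<^bold>\<and> cA y x \<^bold>\<and> i y)"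
| "base_cond A (I1 x) = (p x \<^bold>\<and> o' x \<^bold>\<and> BigAnd A (\<lambda>y. (cA y x \<^bold>\<and> \<^bold>\<not> i y) \<^bold>\<or> \<^bold>\<not> cA y x))"
| "base_cond A (I2 x) = (p x \<^bold>\<and> \<^bold>\<not> i x \<^bold>\<and> BigAnd A (\<lambda>y. (cA y x \<^bold>\<and> o' y) \<^bold>\<or> \<^bold>\<not> cA y x))"

fun base_eff :: "'a base_event \<Rightarrow> 'a literal set" where
  "base_eff (Delta1 y x) = {Neg (In x)}"
| "base_eff (Delta2 y x) = {Pos (Out x)}"
| "base_eff (I1 x) = {Neg (Out x)}"
| "base_eff (I2 x) = {Pos (In x)}"

fun target :: "'a base_event \<Rightarrow> 'a" where
  "target (Delta1 y x) = x"
| "target (Delta2 y x) = x"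
| "target (I1 x) = x"
| "target (I2 x) = x"

definition base_events :: "'a set \<Rightarrow> 'a base_event set" where
  "base_events A =
     {Delta1 y x | y x. y \<in> A \<and> x \<in> A} \<union> {Delta2 y x | y x. y \<in> A \<and> x \<in> A} \<union> I1 ` A \<union> I2 ` A"

text \<open>Actions have no triggering condition; the unsatisfiable formula is a dummy value.\<close>

fun mod_tri :: "'a set \<Rightarrow> 'a event \<Rightarrow> 'a formula" where
  "mod_tri A (Enunciate x) = (\<^bold>\<not> \<^bold>\<top>)"
| "mod_tri A (Exo Vf b) = (base_cond A b \<^bold>\<and> \<^bold>\<not> l (target b))"
| "mod_tri A (Exo Vl b) = (base_cond A b \<^bold>\<and> l (target b))"

fun mod_pre :: "'a set \<Rightarrow> 'a event \<Rightarrow> 'a formula" where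
  "mod_pre A (Enunciate x) = \<^bold>\<top>"
| "mod_pre A (Exo v b) = mod_tri A (Exo v b)"

fun mod_eff :: "'a event \<Rightarrow> 'a literal set" where
  "mod_eff (Enunciate x) = {Pos (Present x), Pos (Last x), Pos (In x), Neg (Out x)}"
| "mod_eff (Exo Vf b) = base_eff b"
| "mod_eff (Exo Vl b) = base_eff b \<union> {Neg (Last (target b))}"

definition mod_prio :: "'a set \<Rightarrow> ('a event \<times> 'a event) set" where
  "mod_prio A =
     {(Exo v (I1 x), Exo v (I2 x)) | v x. x \<in> A} \<union>
     {(Exo v (I1 x1), Exo v (Delta2 y2 x2)) | v x1 y2 x2. x1 \<in> A \<and> y2 \<in> A \<and> x2 \<in> A} \<union>
     {(Exo v (Delta1 y1 x1), Exo v (Delta2 y2 x2)) | v y1 x1 y2 x2.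
        y1 \<in> A \<and> x1 \<in> A \<and> y2 \<in> A \<and> x2 \<in> A} \<union>
     Exo Vf ` base_events A \<times> Exo Vl ` base_events A"

definition mod_init :: "'a set \<Rightarrow> ('a \<times> 'a) set \<Rightarrow> 'a state" where
  "mod_init A R =
     (\<Union>x\<in>A. {Neg (Present x), Neg (In x), Pos (Out x), Neg (Last x)}) \<union>
     {Pos (CanAttack y x) | y x. y \<in> A \<and> x \<in> A \<and> (y, x) \<in> R} \<union>
     {Neg (CanAttack y x) | y x. y \<in> A \<and> x \<in> A \<and> (y, x) \<notin> R}"

definition modified_context :: "'a set \<Rightarrow> ('a \<times> 'a) set \<Rightarrow> 'a arg_context" where
  "modified_context A R =
     \<lparr>Fluents = fluents A,
      Init = mod_init A R,
      Actions = Enunciate ` A,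
      Exogenous = Exo Vf ` base_events A \<union> Exo Vl ` base_events A,
      Pre = mod_pre A,
      Tri = mod_tri A,
      Eff = mod_eff,
      Prio = mod_prio A\<rparr>"


section \<open>Argumentative states and labellings\<close>

definition argumentative :: "'a set \<Rightarrow> 'a state \<Rightarrow> bool" where
  "argumentative A S \<longleftrightarrow> is_state (fluents A) S \<and>
     (\<forall>x\<in>A.
        ((S \<Turnstile> p x \<^bold>\<and> i x \<^bold>\<and> \<^bold>\<not> o' x) \<longleftrightarrow>
           (S \<Turnstile> p x \<^bold>\<and> BigAnd A (\<lambda>y. (cA y x \<^bold>\<and> \<^bold>\<not> i y \<^bold>\<and> o' y) \<^bold>\<or> \<^bold>\<not> cA y x))) \<and>
        ((S \<Turnstile> p x \<^bold>\<and> \<^bold>\<not> i x \<^bold>\<and> o' x) \<longleftrightarrow>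
           (\<exists>y\<in>A. S \<Turnstile> p x \<^bold>\<and> p y \<^bold>\<and> cA y x \<^bold>\<and> i y \<^bold>\<and> \<^bold>\<not> o' y)))"

datatype label = IN | OUT | UNDEC

text \<open>Labellings are partial maps; a labelling of the framework has domain \<open>A\<close>.\<close>

definition complete_labelling :: "'a set \<Rightarrow> ('a \<times> 'a) set \<Rightarrow> ('a \<rightharpoonup> label) \<Rightarrow> bool" where
  "complete_labelling A R L \<longleftrightarrow> dom L = A \<and>
     (\<forall>x\<in>A.
        (L x = Some IN \<longleftrightarrow> (\<forall>y. (y, x) \<in> R \<longrightarrow> L y = Some OUT)) \<and>
        (L x = Some OUT \<longleftrightarrow> (\<exists>y. (y, x) \<in> R \<and> L y = Some IN)))"

text \<open>A present argument with both \<open>i\<close> and \<open>o\<close> true gets no label.\<close>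

definition assoc_labelling :: "'a set \<Rightarrow> 'a state \<Rightarrow> ('a \<rightharpoonup> label)" where
  "assoc_labelling A S = (\<lambda>x.
     if x \<in> A \<and> (S \<Turnstile> p x) then
       if S \<Turnstile> i x \<^bold>\<and> \<^bold>\<not> o' x then Some IN
       else if S \<Turnstile> \<^bold>\<not> i x \<^bold>\<and> o' x then Some OUT
       else if S \<Turnstile> \<^bold>\<not> i x \<^bold>\<and> \<^bold>\<not> o' x then Some UNDEC
       else None
     else None)"

hide_const (open) p i o' l cA

end

theory Submission
  imports Defs
begin

text \<open>Enunciate first all arguments of \<open>A\<close> simultaneously and then, once the exogenous events have
  settled, again all arguments labelled IN, simultaneously. In the first phase every attacked argument is
  hit by a \<open>\<Delta>\<^sup>1\<^sup>l\<close> event and loses \<open>i\<close> and \<open>l\<close>; afterwards \<open>i\<close> and \<open>o\<close> only grow and remain below \<open>L\<close>,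
  as in the iteration towards the grounded labelling. In the second phase the arguments labelled IN carry
  \<open>l\<close> and the arguments labelled OUT do not, so by the priority of the f-events all arguments
  labelled OUT become out before an attack on an argument labelled IN could be processed; then nothing
  is triggered any more and the labelling is \<open>L\<close>. Uniqueness of the path holds because the
  exogenous events at a state are forced to be the maximal triggered ones.\<close>

section \<open>Paths as runs of a deterministic system\<close>

definition triggered :: "'a arg_context \<Rightarrow> 'a state \<Rightarrow> 'a event set" where
  "triggered \<kappa> S = {e \<in> Exogenous \<kappa>. S \<Turnstile> Tri \<kappa> e}"

definition top_triggered :: "'a arg_context \<Rightarrow> 'a state \<Rightarrow> 'a event set" where
  "top_triggered \<kappa> S = {e \<in> triggered \<kappa> S. \<forall>e'\<in>triggered \<kappa> S. (e', e) \<notin> Prio \<kappa>}"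

definition valid_events :: "'a arg_context \<Rightarrow> 'a state \<Rightarrow> 'a event set \<Rightarrow> bool" where
  "valid_events \<kappa> S E \<longleftrightarrow>
     is_state (Fluents \<kappa>) S \<and>
     E \<subseteq> Actions \<kappa> \<union> Exogenous \<kappa> \<and>
     (\<forall>e\<in>E. S \<Turnstile> Pre \<kappa> e) \<and>
     (\<forall>e\<in>E. \<forall>e'\<in>E. (e, e') \<notin> Prio \<kappa>) \<and>
     (\<forall>e\<in>Exogenous \<kappa>. (S \<Turnstile> Tri \<kappa> e) \<longrightarrow> e \<in> E \<or> (\<exists>e'\<in>E. (e', e) \<in> Prio \<kappa>)) \<and>
     (E \<inter> Actions \<kappa> \<noteq> {} \<longrightarrow> (\<forall>e'\<in>Exogenous \<kappa>. \<not> (S \<Turnstile> Tri \<kappa> e'))) \<and>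
     E \<noteq> {}"

lemma valid_path_iff:
  "valid_path \<kappa> (Ss, Es) \<longleftrightarrow> length Ss = Suc (length Es) \<and> Ss ! 0 = Init \<kappa> \<and>
     (\<forall>t<length Es. valid_events \<kappa> (Ss ! t) (Es ! t) \<and> Ss ! Suc t = successor \<kappa> (Ss ! t) (Es ! t))"
  unfolding valid_path_def valid_events_def by (simp only: prod.case conj_assoc)

lemma valid_path_Nil: "valid_path \<kappa> (Ss, []) \<longleftrightarrow> Ss = [Init \<kappa>]"
  by (cases Ss) (auto simp: valid_path_iff)

text \<open>Restarting the same context at the successor state, by replacing \<open>Init\<close>,
  lets \<open>valid_path\<close> be treated by induction on the event list.\<close>

lemma valid_path_Cons:
  "valid_path \<kappa> (Ss, E # Es) \<longleftrightarrow>
     (\<exists>Ss'. Ss = Init \<kappa> # Ss' \<and> valid_events \<kappa> (Init \<kappa>) E \<and>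
        valid_path (\<kappa>\<lparr>Init := successor \<kappa> (Init \<kappa>) E\<rparr>) (Ss', Es))"
proof (cases Ss)
  case Nil
  then show ?thesis by (simp add: valid_path_iff)
next
  case (Cons S Ss')
  \<comment> \<open>Neither notion reads \<open>Init\<close>.\<close>
  have "successor (\<kappa>\<lparr>Init := T\<rparr>) = successor \<kappa>" "valid_events (\<kappa>\<lparr>Init := T\<rparr>) = valid_events \<kappa>" for T
    by (simp_all add: successor_def valid_events_def fun_eq_iff)
  then show ?thesis
    unfolding Cons valid_path_iff by (auto simp: All_less_Suc2)
qed

text \<open>\<open>Bs\<close> is the agenda of action sets still to be performed. It is consumed
  only in states where nothing is triggered, so at most one rule applies to given \<open>S\<close>
  and \<open>Bs\<close>.\<close>

inductive run :: "'a arg_context \<Rightarrow> 'a state \<Rightarrow> 'a event set list \<Rightarrow> 'a state list \<Rightarrow> 'a event set list \<Rightarrow> bool"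
  for \<kappa> where
  stop: "run \<kappa> S [] [S] []" if "triggered \<kappa> S = {}"
| exo: "run \<kappa> S Bs (S # Ss) (top_triggered \<kappa> S # Es)"
  if "is_state (Fluents \<kappa>) S" "triggered \<kappa> S \<noteq> {}"
    "run \<kappa> (successor \<kappa> S (top_triggered \<kappa> S)) Bs Ss Es"
| act: "run \<kappa> S (B # Bs) (S # Ss) (B # Es)"
  if "is_state (Fluents \<kappa>) S" "triggered \<kappa> S = {}" "B \<subseteq> Actions \<kappa>" "B \<noteq> {}"
    "run \<kappa> (successor \<kappa> S B) Bs Ss Es"

lemma run_nonempty: "run \<kappa> S Bs Ss Es \<Longrightarrow> Ss \<noteq> []"
  by (induction rule: run.induct) auto

text \<open>Forgets the intermediate states, so that phases can be chained by prepending
  steps.\<close>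

definition outcome :: "'a arg_context \<Rightarrow> 'a state \<Rightarrow> 'a event set list \<Rightarrow> 'a state \<Rightarrow> bool" where
  "outcome \<kappa> S Bs T \<longleftrightarrow> (\<exists>Ss Es. run \<kappa> S Bs Ss Es \<and> last Ss = T)"

lemma outcome_stop: "triggered \<kappa> S = {} \<Longrightarrow> outcome \<kappa> S [] S"
  unfolding outcome_def by (metis last.simps run.stop)

lemma outcome_exo:
  assumes "is_state (Fluents \<kappa>) S" "triggered \<kappa> S \<noteq> {}"
    and "outcome \<kappa> (successor \<kappa> S (top_triggered \<kappa> S)) Bs T"
  shows "outcome \<kappa> S Bs T"
  using assms unfolding outcome_def by (metis last_ConsR run.exo run_nonempty)

lemma outcome_act:
  assumes "is_state (Fluents \<kappa>) S" "triggered \<kappa> S = {}" "B \<subseteq> Actions \<kappa>" "B \<noteq> {}"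
    and "outcome \<kappa> (successor \<kappa> S B) Bs T"
  shows "outcome \<kappa> S (B # Bs) T"
  using assms unfolding outcome_def by (metis last_ConsR run.act run_nonempty)

lemma run_unique:
  assumes "run \<kappa> S Bs Ss Es" "run \<kappa> S Bs Ss' Es'"
  shows "Ss = Ss' \<and> Es = Es'"
  using assms
proof (induction arbitrary: Ss' Es' rule: run.induct)
  case (stop S)
  from stop.prems stop.hyps show ?case by cases auto
next
  case (exo S Bs Ss Es)
  from exo.prems exo.hyps(2) show ?case by cases (use exo.IH in auto)
next
  case (act S B Bs Ss Es)
  from act.prems act.hyps(2) show ?case by cases (use act.IH in auto)
qed

section \<open>Contexts whose priorities determine the exogenous events\<close>

locale prioritised_context =
  fixes \<kappa> :: "'a arg_context"
  assumes disjoint: "Actions \<kappa> \<inter> Exogenous \<kappa> = {}"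
    and pre_action: "a \<in> Actions \<kappa> \<Longrightarrow> S \<Turnstile> Pre \<kappa> a"
    and pre_exogenous: "e \<in> Exogenous \<kappa> \<Longrightarrow> Pre \<kappa> e = Tri \<kappa> e"
    and prio_exogenous: "Prio \<kappa> \<subseteq> Exogenous \<kappa> \<times> Exogenous \<kappa>"
    and trans_prio: "trans (Prio \<kappa>)"
    and wf_prio: "wf (Prio \<kappa>)"
begin

text \<open>Climb from \<open>e\<close> to triggered events of higher priority. The dominating event
  is the smaller one in \<open>Prio\<close>, so \<open>wf_prio\<close> ends the climb, and
  \<open>trans_prio\<close> relates its end to \<open>e\<close>.\<close>

lemma top_triggered_dominates:
  assumes "e \<in> triggered \<kappa> S"
  shows "e \<in> top_triggered \<kappa> S \<or> (\<exists>e'\<in>top_triggered \<kappa> S. (e', e) \<in> Prio \<kappa>)"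
  using assms
proof (induction e rule: wf_induct_rule[OF wf_prio])
  case (1 e)
  then show ?case
    using trans_prio unfolding top_triggered_def by (blast dest: transD)
qed

lemma top_triggered_nonempty: "triggered \<kappa> S \<noteq> {} \<Longrightarrow> top_triggered \<kappa> S \<noteq> {}"
  using top_triggered_dominates by blast

text \<open>If nothing is triggered, exogenous preconditions fail because they equal the triggers.
  Otherwise actions are excluded, and a set of pairwise incomparable triggered events that contains
  or dominates every triggered event consists exactly of the maximal ones.\<close>

lemma valid_events_iff:
  "valid_events \<kappa> S E \<longleftrightarrow> is_state (Fluents \<kappa>) S \<and>
     (if triggered \<kappa> S = {} then E \<subseteq> Actions \<kappa> \<and> E \<noteq> {} else E = top_triggered \<kappa> S)"
proof (cases "triggered \<kappa> S = {}")
  case True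
  then have no_tri: "\<not> (S \<Turnstile> Tri \<kappa> e)" if "e \<in> Exogenous \<kappa>" for e
    using that by (auto simp: triggered_def)
  then have no_pre: "\<not> (S \<Turnstile> Pre \<kappa> e)" if "e \<in> Exogenous \<kappa>" for e
    using that pre_exogenous by simp
  have "E \<subseteq> Actions \<kappa>" if "valid_events \<kappa> S E"
    using that no_pre unfolding valid_events_def by blast
  moreover have "(e, e') \<notin> Prio \<kappa>" if "E \<subseteq> Actions \<kappa>" "e \<in> E" for e e'
    using that disjoint prio_exogenous by blast
  ultimately show ?thesis
    using True no_tri pre_action by (auto simp: valid_events_def)
next
  case False
  have "E = top_triggered \<kappa> S" if "valid_events \<kappa> S E"
  proof -
    from that False have "E \<subseteq> Exogenous \<kappa>"
      unfolding valid_events_def triggered_def by blast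
    with that have *: "E \<subseteq> triggered \<kappa> S" "\<forall>e\<in>E. \<forall>e'\<in>E. (e, e') \<notin> Prio \<kappa>"
      "\<forall>e\<in>triggered \<kappa> S. e \<in> E \<or> (\<exists>e'\<in>E. (e', e) \<in> Prio \<kappa>)"
      unfolding valid_events_def triggered_def by (auto simp: pre_exogenous subset_iff)
    \<comment> \<open>A triggered event above a member of \<open>E\<close> is in \<open>E\<close> or
      below another member; by transitivity both cases give comparable events in
      \<open>E\<close>.\<close>
    have "E \<subseteq> top_triggered \<kappa> S"
      using * trans_prio unfolding top_triggered_def by (blast dest: transD)
    moreover have "top_triggered \<kappa> S \<subseteq> E"
      using * unfolding top_triggered_def by blast
    ultimately show ?thesis by blast
  qed
  moreover have "valid_events \<kappa> S (top_triggered \<kappa> S)" if "is_state (Fluents \<kappa>) S"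
    using that top_triggered_dominates[of _ S] top_triggered_nonempty[OF False] disjoint
    unfolding valid_events_def
    by (auto simp: top_triggered_def triggered_def pre_exogenous)
  ultimately show ?thesis
    using False by (auto simp: valid_events_def)
qed

lemma top_triggered_no_action: "top_triggered \<kappa> S \<inter> Actions \<kappa> = {}"
  using disjoint by (auto simp: top_triggered_def triggered_def)

text \<open>\<open>valid_events_iff\<close> decides which rule of \<open>run\<close> produces the
  first step. Exogenous steps have an empty action part, so filtering these out recovers the
  agenda.\<close>

lemma run_iff_valid_path:
  "run \<kappa> S Bs Ss Es \<longleftrightarrow>
     valid_path (\<kappa>\<lparr>Init := S\<rparr>) (Ss, Es) \<and>
     filter (\<lambda>B. B \<noteq> {}) (map (\<lambda>E. E \<inter> Actions \<kappa>) Es) = Bs \<and>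
     triggered \<kappa> (last Ss) = {}"
proof (induction Es arbitrary: S Bs Ss)
  case Nil
  show ?case
    by (subst run.simps) (auto simp: valid_path_Nil)
next
  case (Cons E Es)
  have eq: "valid_events (\<kappa>\<lparr>Init := T\<rparr>) = valid_events \<kappa>"
    "successor (\<kappa>\<lparr>Init := T\<rparr>) = successor \<kappa>" for T
    by (simp_all add: valid_events_def successor_def fun_eq_iff)
  have nonempty: "\<not> valid_path (\<kappa>\<lparr>Init := T\<rparr>) ([], Es)" for T
    by (simp add: valid_path_iff)
  show ?case
  proof (cases "triggered \<kappa> S = {}")
    case True
    then have "run \<kappa> S Bs Ss (E # Es) \<longleftrightarrow>
      (\<exists>Ss' Bs'. Ss = S # Ss' \<and> Bs = E # Bs' \<and> valid_events \<kappa> S E \<and>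
         run \<kappa> (successor \<kappa> S E) Bs' Ss' Es)"
      by (subst run.simps) (auto simp: valid_events_iff)
    moreover have "E \<inter> Actions \<kappa> = E" "E \<noteq> {}" if "valid_events \<kappa> S E"
      using that True by (auto simp: valid_events_iff)
    ultimately show ?thesis
      by (auto simp: valid_path_Cons eq Cons.IH nonempty split: if_splits)
  next
    case False
    then have "run \<kappa> S Bs Ss (E # Es) \<longleftrightarrow>
      (\<exists>Ss'. Ss = S # Ss' \<and> valid_events \<kappa> S E \<and> run \<kappa> (successor \<kappa> S E) Bs Ss' Es)"
      by (subst run.simps) (auto simp: valid_events_iff)
    moreover have "E \<inter> Actions \<kappa> = {}" if "valid_events \<kappa> S E"
      using that False top_triggered_no_action by (auto simp: valid_events_iff)
    ultimately show ?thesis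
      by (auto simp: valid_path_Cons eq Cons.IH nonempty split: if_splits)
  qed
qed

end

section \<open>Scheduling of ranked actions\<close>

definition rank_actions :: "('b \<times> nat) set \<Rightarrow> 'b set list" where
  "rank_actions \<sigma> = map (\<lambda>r. {a. (a, r) \<in> \<sigma>}) (sorted_list_of_set (snd ` \<sigma>))"

lemma filter_eq_map_nth: "filter P xs = map ((!) xs) (filter (\<lambda>t. P (xs ! t)) [0..<length xs])"
proof -
  have "filter P xs = filter P (map ((!) xs) [0..<length xs])"
    by (simp only: map_nth)
  then show ?thesis by (simp add: filter_map comp_def)
qed

text \<open>Trades the time map of \<open>performs\<close> for an equation of lists. A strictly
  monotone \<open>\<tau>\<close> enumerates the nonempty positions of \<open>Bs\<close> in
  increasing order, and a strictly increasing list is determined by its set. Entries of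
  \<open>rank_actions\<close> are nonempty since only occurring ranks contribute.\<close>

lemma scheduled_iff:
  fixes \<sigma> :: "('b \<times> nat) set"
  assumes fin: "finite \<sigma>"
  shows "(\<exists>\<tau> :: nat \<Rightarrow> nat. strict_mono_on (snd ` \<sigma>) \<tau> \<and> (\<forall>r\<in>snd ` \<sigma>. \<tau> r < length Bs) \<and>
       (\<forall>t<length Bs. Bs ! t = {a. \<exists>r. (a, r) \<in> \<sigma> \<and> \<tau> r = t})) \<longleftrightarrow>
     filter (\<lambda>B. B \<noteq> {}) Bs = rank_actions \<sigma>" (is "?lhs \<longleftrightarrow> ?rhs")
proof -
  define rs where "rs = sorted_list_of_set (snd ` \<sigma>)"
  define ts where "ts = filter (\<lambda>t. Bs ! t \<noteq> {}) [0..<length Bs]"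
  have rs: "sorted_wrt (<) rs" "set rs = snd ` \<sigma>"
    using fin by (simp_all add: rs_def)
  have ts: "sorted_wrt (<) ts" "set ts = {t. t < length Bs \<and> Bs ! t \<noteq> {}}"
    by (auto simp: ts_def sorted_wrt_filter)
  have Bs: "filter (\<lambda>B. B \<noteq> {}) Bs = map ((!) Bs) ts"
    unfolding ts_def by (rule filter_eq_map_nth)
  have rank: "rank_actions \<sigma> = map (\<lambda>r. {a. (a, r) \<in> \<sigma>}) rs"
    by (simp add: rank_actions_def rs_def)
  show ?thesis
  proof
    assume ?lhs
    then obtain \<tau> :: "nat \<Rightarrow> nat" where mono: "strict_mono_on (snd ` \<sigma>) \<tau>"
      and less: "\<forall>r\<in>snd ` \<sigma>. \<tau> r < length Bs"
      and nth: "\<forall>t<length Bs. Bs ! t = {a. \<exists>r. (a, r) \<in> \<sigma> \<and> \<tau> r = t}"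
      by (elim exE conjE) (rule that)
    have "sorted_wrt (<) (map \<tau> rs)"
      unfolding sorted_wrt_map
      by (rule sorted_wrt_mono_rel[OF _ rs(1)]) (use mono rs(2) in \<open>auto simp: strict_mono_on_def\<close>)
    moreover have "set (map \<tau> rs) = set ts"
    proof (intro set_eqI iffI)
      fix t assume "t \<in> set (map \<tau> rs)"
      then obtain a r where "(a, r) \<in> \<sigma>" "t = \<tau> r"
        by (auto simp: rs(2))
      moreover have "\<tau> r < length Bs"
        using less \<open>(a, r) \<in> \<sigma>\<close> by force
      ultimately show "t \<in> set ts"
        using nth by (auto simp: ts(2))
    next
      fix t assume "t \<in> set ts"
      then obtain a where "t < length Bs" "a \<in> Bs ! t"
        by (auto simp: ts(2))
      then obtain r where "(a, r) \<in> \<sigma>" "\<tau> r = t"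
        using nth by blast
      then show "t \<in> set (map \<tau> rs)"
        by (force simp: rs(2))
    qed
    ultimately have "ts = map \<tau> rs"
      using ts(1) by (metis strict_sorted_equal)
    moreover have "Bs ! \<tau> r = {a. (a, r) \<in> \<sigma>}" if "r \<in> set rs" for r
    proof -
      \<comment> \<open>Injectivity of \<open>\<tau>\<close>: no other rank contributes actions at
        the time \<open>\<tau> r\<close>.\<close>
      have "r' = r" if "(a, r') \<in> \<sigma>" "\<tau> r' = \<tau> r" for a r'
        using strict_mono_on_imp_inj_on[OF mono] that \<open>r \<in> set rs\<close>
        by (auto simp: rs(2) inj_on_def image_iff)
      moreover have "\<tau> r < length Bs"
        using less that rs(2) by blast
      ultimately show ?thesis
        using nth by blast
    qed
    ultimately show ?rhs by (simp add: Bs rank)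
  next
    assume ?rhs
    then have eq: "map ((!) Bs) ts = map (\<lambda>r. {a. (a, r) \<in> \<sigma>}) rs"
      by (simp add: Bs rank)
    then have len: "length ts = length rs"
      by (rule map_eq_imp_length_eq)
    \<comment> \<open>The \<open>k\<close>-th occurring rank goes to the \<open>k\<close>-th
      nonempty position. Other ranks get \<open>the None\<close>, which no condition
      inspects.\<close>
    define \<tau> where "\<tau> = (\<lambda>r. the (map_of (zip rs ts) r))"
    have \<tau>: "\<tau> (rs ! k) = ts ! k" if "k < length rs" for k
      using that len rs(1) by (simp add: \<tau>_def map_of_zip_nth strict_sorted_iff)
    have inds: "\<exists>k<length rs. r = rs ! k" if "r \<in> snd ` \<sigma>" for r
      using that by (metis in_set_conv_nth rs(2))
    have "strict_mono_on (snd ` \<sigma>) \<tau>"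
    proof (rule strict_mono_onI)
      fix r r' assume "r \<in> snd ` \<sigma>" "r' \<in> snd ` \<sigma>" "r < r'"
      then obtain k k' where k: "k < length rs" "r = rs ! k" "k' < length rs" "r' = rs ! k'"
        using inds by metis
      have "k < k'"
      proof (rule ccontr)
        assume "\<not> k < k'"
        then have "rs ! k' \<le> rs ! k"
          using k rs(1) by (metis not_less sorted_nth_mono strict_sorted_imp_sorted)
        with k \<open>r < r'\<close> show False by simp
      qed
      then show "\<tau> r < \<tau> r'"
        using k len sorted_wrt_nth_less[OF ts(1)] by (simp add: \<tau>)
    qed
    moreover have "\<forall>r\<in>snd ` \<sigma>. \<tau> r < length Bs"
      using inds \<tau> len ts(2) nth_mem by (metis (mono_tags, lifting) mem_Collect_eq)
    moreover have "Bs ! t = {a. \<exists>r. (a, r) \<in> \<sigma> \<and> \<tau> r = t}" if "t < length Bs" for t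
    proof (cases "t \<in> set ts")
      case True
      then obtain k where k: "k < length rs" "t = ts ! k"
        using len by (metis in_set_conv_nth)
      have "Bs ! t = {a. (a, rs ! k) \<in> \<sigma>}"
        using arg_cong[OF eq, of "\<lambda>xs. xs ! k"] k len by simp
      moreover have "r = rs ! k" if "(a, r) \<in> \<sigma>" "\<tau> r = t" for a r
        using \<open>strict_mono_on (snd ` \<sigma>) \<tau>\<close>[THEN strict_mono_on_imp_inj_on] that k \<tau>[OF k(1)] rs(2)
        by (metis image_eqI inj_onD nth_mem snd_conv)
      ultimately show ?thesis
        using \<tau>[OF k(1)] k(2) by auto
    next
      case False
      then have "Bs ! t = {}" using that ts(2) by simp
      moreover have "\<tau> r \<in> set ts" if "r \<in> snd ` \<sigma>" for r
        using inds[OF that] \<tau> len by (metis nth_mem)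
      ultimately show ?thesis
        using False by (auto simp: image_iff) (metis snd_conv)
    qed
    ultimately show ?lhs by blast
  qed
qed

text \<open>Existence and uniqueness of the valid path thereby become questions about runs with a
  fixed agenda.\<close>

lemma (in prioritised_context) valid_path_wrt_iff_run:
  assumes "finite \<sigma>"
  shows "valid_path_wrt (\<sigma>, \<kappa>) (Ss, Es) \<longleftrightarrow> run \<kappa> (Init \<kappa>) (rank_actions \<sigma>) Ss Es"
proof -
  have "performs \<kappa> \<sigma> Es \<longleftrightarrow>
    filter (\<lambda>B. B \<noteq> {}) (map (\<lambda>E. E \<inter> Actions \<kappa>) Es) = rank_actions \<sigma>"
    unfolding performs_def scheduled_iff[OF assms, symmetric] by (simp cong: conj_cong)
  then show ?thesis
    by (auto simp: valid_path_wrt_def run_iff_valid_path triggered_def)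
qed

section \<open>Finiteness of the fluents and consistency of successor states\<close>

lemma finite_fluents:
  assumes "finite A"
  shows "finite (fluents A)"
proof -
  have "{CanAttack y x | y x. y \<in> A \<and> x \<in> A} = (\<lambda>(y, x). CanAttack y x) ` (A \<times> A)"
    by auto
  with assms show ?thesis by (simp add: fluents_def)
qed

text \<open>Events with conflicting effects could put a fluent and its negation into the successor.
  Without conflicts a state results, and it suffices to track positive literals from then
  on.\<close>

lemma successor_consistent:
  assumes "is_state (Fluents \<kappa>) S"
    and "\<And>e. e \<in> E \<Longrightarrow> Eff \<kappa> e \<subseteq> literals (Fluents \<kappa>)"
    and "\<And>e e' f. e \<in> E \<Longrightarrow> e' \<in> E \<Longrightarrow> Pos f \<in> Eff \<kappa> e \<Longrightarrow> Neg f \<notin> Eff \<kappa> e'"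
  shows "is_state (Fluents \<kappa>) (successor \<kappa> S E)"
    and "Pos f \<in> successor \<kappa> S E \<longleftrightarrow>
      (Pos f \<in> S \<and> (\<forall>e\<in>E. Neg f \<notin> Eff \<kappa> e)) \<or> (\<exists>e\<in>E. Pos f \<in> Eff \<kappa> e)"
proof -
  have lit: "k \<in> literals (Fluents \<kappa>) \<and> (\<exists>e\<in>E. k \<in> Eff \<kappa> e) \<longleftrightarrow> (\<exists>e\<in>E. k \<in> Eff \<kappa> e)" for k
    using assms(2) by blast
  show pos: "Pos f \<in> successor \<kappa> S E \<longleftrightarrow>
      (Pos f \<in> S \<and> (\<forall>e\<in>E. Neg f \<notin> Eff \<kappa> e)) \<or> (\<exists>e\<in>E. Pos f \<in> Eff \<kappa> e)" for f
    using lit[of "Pos f"] by (auto simp: successor_def)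
  have neg: "Neg f \<in> successor \<kappa> S E \<longleftrightarrow>
      (Neg f \<in> S \<and> (\<forall>e\<in>E. Pos f \<notin> Eff \<kappa> e)) \<or> (\<exists>e\<in>E. Neg f \<in> Eff \<kappa> e)" for f
    using lit[of "Neg f"] by (auto simp: successor_def)
  have "successor \<kappa> S E \<subseteq> literals (Fluents \<kappa>)"
    using assms(1) by (auto simp: successor_def is_state_def)
  then show "is_state (Fluents \<kappa>) (successor \<kappa> S E)"
    using assms(1,3) unfolding is_state_def pos neg by blast
qed

section \<open>The modified context\<close>

lemma base_events_simps [simp]:
  "Delta1 y x \<in> base_events A \<longleftrightarrow> y \<in> A \<and> x \<in> A"
  "Delta2 y x \<in> base_events A \<longleftrightarrow> y \<in> A \<and> x \<in> A"
  "I1 x \<in> base_events A \<longleftrightarrow> x \<in> A"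
  "I2 x \<in> base_events A \<longleftrightarrow> x \<in> A"
  by (auto simp: base_events_def)

fun base_level :: "'a base_event \<Rightarrow> nat" where
  "base_level (I1 x) = 0"
| "base_level (Delta1 y x) = 0"
| "base_level (I2 x) = 1"
| "base_level (Delta2 y x) = 1"

text \<open>A measure for well-foundedness of the priorities. The offset 2 exceeds every base level
  and so places all f-events before all l-events; the value on actions is a dummy, as they are never
  prioritised.\<close>

fun event_level :: "'a event \<Rightarrow> nat" where
  "event_level (Exo Vf b) = base_level b"
| "event_level (Exo Vl b) = base_level b + 2"
| "event_level (Enunciate x) = 0"

lemma base_level_le: "base_level b \<le> 1"
  by (cases b) auto

lemma mod_prio_level: "(e, e') \<in> mod_prio A \<Longrightarrow> event_level e < event_level e'"
proof -
  have *: "event_level (Exo v b) < event_level (Exo v c)" if "base_level b < base_level c"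
    for v and b c :: "'a base_event"
    using that by (cases v) auto
  have "event_level (Exo Vf b) < event_level (Exo Vl c)" for b c :: "'a base_event"
    using base_level_le[of b] by simp
  with * show "(e, e') \<in> mod_prio A \<Longrightarrow> event_level e < event_level e'"
    unfolding mod_prio_def by fastforce
qed

lemma wf_mod_prio: "wf (mod_prio A)"
  by (rule wf_subset[OF wf_measure[of event_level]]) (auto simp: mod_prio_level)

lemma Exo_in_exogenous [simp]:
  "Exo v b \<in> Exo Vf ` B \<or> Exo v b \<in> Exo Vl ` B \<longleftrightarrow> b \<in> B"
  by (cases v) auto

lemma exogenous_eq: "Exo Vf ` B \<union> Exo Vl ` B = {Exo v b | v b. b \<in> B}"
proof -
  have "Exo v b \<in> Exo Vf ` B \<union> Exo Vl ` B" if "b \<in> B" for v b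
    using that by (cases v) auto
  then show ?thesis by blast
qed

lemma mod_prio_exogenous:
  "mod_prio A \<subseteq> (Exo Vf ` base_events A \<union> Exo Vl ` base_events A) \<times>
     (Exo Vf ` base_events A \<union> Exo Vl ` base_events A)"
  unfolding exogenous_eq mod_prio_def by auto

lemma mod_prio_simps:
  "(Exo v b, Exo w c) \<in> mod_prio A \<longleftrightarrow> b \<in> base_events A \<and> c \<in> base_events A \<and>
     (v = Vf \<and> w = Vl \<or>
      v = w \<and> ((\<exists>x. b = I1 x \<and> c = I2 x) \<or> (\<exists>x y' x'. b = I1 x \<and> c = Delta2 y' x') \<or>
               (\<exists>y x y' x'. b = Delta1 y x \<and> c = Delta2 y' x')))"
  unfolding mod_prio_def by auto

text \<open>Within one version, dominating events (\<open>I1\<close>, \<open>Delta1\<close>) are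
  never dominated ones (\<open>I2\<close>, \<open>Delta2\<close>). Of two consecutive steps exactly
  one therefore passes from \<open>Vf\<close> to \<open>Vl\<close>, and so does their
  composition.\<close>

lemma trans_mod_prio: "trans (mod_prio A)"
proof (rule transI)
  fix e1 e2 e3 assume *: "(e1, e2) \<in> mod_prio A" "(e2, e3) \<in> mod_prio A"
  then obtain v1 b1 v2 b2 v3 b3 where "e1 = Exo v1 b1" "e2 = Exo v2 b2" "e3 = Exo v3 b3"
    using mod_prio_exogenous[of A, unfolded exogenous_eq] by blast
  with * show "(e1, e3) \<in> mod_prio A"
    by (auto simp: mod_prio_simps)
qed

section \<open>Triggering and enunciation in the modified context\<close>

locale attack_framework =
  fixes A :: "'a set" and R :: "('a \<times> 'a) set"
  assumes finite_args: "finite A" and attacks: "R \<subseteq> A \<times> A"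
begin

abbreviation \<kappa> :: "'a arg_context" where
  "\<kappa> \<equiv> modified_context A R"

lemma context_sel [simp]:
  "Fluents \<kappa> = fluents A" "Init \<kappa> = mod_init A R" "Actions \<kappa> = Enunciate ` A"
  "Exogenous \<kappa> = Exo Vf ` base_events A \<union> Exo Vl ` base_events A"
  "Pre \<kappa> = mod_pre A" "Tri \<kappa> = mod_tri A" "Eff \<kappa> = mod_eff" "Prio \<kappa> = mod_prio A"
  by (simp_all add: modified_context_def)

sublocale prioritised_context \<kappa>
proof
  show "Pre \<kappa> e = Tri \<kappa> e" if "e \<in> Exogenous \<kappa>" for e
    using that by auto
qed (use mod_prio_exogenous[of A] in \<open>auto simp: trans_mod_prio wf_mod_prio\<close>)

lemma mod_tri_iff: "(S \<Turnstile> mod_tri A (Exo v b)) \<longleftrightarrow>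
    (S \<Turnstile> base_cond A b) \<and> (Pos (Last (target b)) \<in> S \<longleftrightarrow> v = Vl)"
  by (cases v) auto

lemma triggered_iff: "e \<in> triggered \<kappa> S \<longleftrightarrow>
    (\<exists>v b. e = Exo v b \<and> b \<in> base_events A \<and> (S \<Turnstile> base_cond A b) \<and>
       (Pos (Last (target b)) \<in> S \<longleftrightarrow> v = Vl))"
  by (cases e) (auto simp: triggered_def mod_tri_iff simp del: mod_tri.simps)

lemma triggered_Exo_iff: "Exo v b \<in> triggered \<kappa> S \<longleftrightarrow>
    b \<in> base_events A \<and> (S \<Turnstile> base_cond A b) \<and> (Pos (Last (target b)) \<in> S \<longleftrightarrow> v = Vl)"
  by (simp add: triggered_iff)

lemma mod_eff_literals:
  assumes "e \<in> Actions \<kappa> \<union> Exogenous \<kappa>"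
  shows "Eff \<kappa> e \<subseteq> literals (Fluents \<kappa>)"
proof -
  have "mod_eff (Exo v b) \<subseteq> literals (fluents A)" if "b \<in> base_events A" for v b
    using that by (cases v; cases b) (auto simp: literals_def fluents_def)
  moreover have "mod_eff (Enunciate x) \<subseteq> literals (fluents A)" if "x \<in> A" for x
    using that by (auto simp: literals_def fluents_def)
  ultimately show ?thesis using assms by auto
qed

text \<open>Simultaneous enunciations never conflict: their only negative effects concern
  \<open>Out\<close>, which none of them makes true.\<close>

lemma enunciate_successor:
  assumes "is_state (fluents A) S" "X \<subseteq> A"
  defines "S' \<equiv> successor \<kappa> S (Enunciate ` X)"
  shows "is_state (fluents A) S'"
    and "Pos (Present x) \<in> S' \<longleftrightarrow> Pos (Present x) \<in> S \<or> x \<in> X"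
    and "Pos (In x) \<in> S' \<longleftrightarrow> Pos (In x) \<in> S \<or> x \<in> X"
    and "Pos (Out x) \<in> S' \<longleftrightarrow> Pos (Out x) \<in> S \<and> x \<notin> X"
    and "Pos (Last x) \<in> S' \<longleftrightarrow> Pos (Last x) \<in> S \<or> x \<in> X"
    and "Pos (CanAttack y x) \<in> S' \<longleftrightarrow> Pos (CanAttack y x) \<in> S"
proof -
  have lit: "Eff \<kappa> e \<subseteq> literals (Fluents \<kappa>)" if "e \<in> Enunciate ` X" for e
    using that assms(2) by (intro mod_eff_literals) auto
  have con: "Neg f \<notin> Eff \<kappa> e'" if "e \<in> Enunciate ` X" "e' \<in> Enunciate ` X" "Pos f \<in> Eff \<kappa> e" for e e' f
    using that by auto
  note sc = successor_consistent[of \<kappa> S "Enunciate ` X", OF _ lit con]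
  show "is_state (fluents A) S'"
    unfolding S'_def using sc(1) assms(1) by simp
  note pos = sc(2)[simplified, OF assms(1), folded S'_def]
  show "Pos (Present x) \<in> S' \<longleftrightarrow> Pos (Present x) \<in> S \<or> x \<in> X"
    "Pos (In x) \<in> S' \<longleftrightarrow> Pos (In x) \<in> S \<or> x \<in> X"
    "Pos (Out x) \<in> S' \<longleftrightarrow> Pos (Out x) \<in> S \<and> x \<notin> X"
    "Pos (Last x) \<in> S' \<longleftrightarrow> Pos (Last x) \<in> S \<or> x \<in> X"
    "Pos (CanAttack y x) \<in> S' \<longleftrightarrow> Pos (CanAttack y x) \<in> S"
    by (auto simp: pos)
qed

lemma is_state_init: "is_state (fluents A) (mod_init A R)"
  by (auto simp: is_state_def literals_def fluents_def mod_init_def)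

lemma init_not_triggered: "triggered \<kappa> (mod_init A R) = {}"
proof -
  have "Pos (Present x) \<notin> mod_init A R" for x
    by (auto simp: mod_init_def)
  then have "\<not> (mod_init A R \<Turnstile> base_cond A b)" for b
    by (cases b) auto
  then show ?thesis by (auto simp: triggered_iff)
qed

definition all_present :: "'a state \<Rightarrow> bool" where
  "all_present S \<longleftrightarrow> is_state (fluents A) S \<and> (\<forall>x\<in>A. Pos (Present x) \<in> S) \<and>
     (\<forall>y\<in>A. \<forall>x\<in>A. Pos (CanAttack y x) \<in> S \<longleftrightarrow> (y, x) \<in> R)"

text \<open>With presence and attackability fixed, only \<open>In\<close> and \<open>Out\<close>
  vary. Attackers lie in \<open>A\<close> by \<open>attacks\<close>, so the bound on
  \<open>y\<close> disappears.\<close>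

lemma all_present_base_cond:
  assumes "all_present S" "b \<in> base_events A"
  shows "(S \<Turnstile> base_cond A b) \<longleftrightarrow> (case b of
      Delta1 y x \<Rightarrow> (y, x) \<in> R \<and> Pos (In x) \<in> S \<and> Pos (Out y) \<notin> S
    | Delta2 y x \<Rightarrow> (y, x) \<in> R \<and> Pos (Out x) \<notin> S \<and> Pos (In y) \<in> S
    | I1 x \<Rightarrow> Pos (Out x) \<in> S \<and> (\<forall>y. (y, x) \<in> R \<longrightarrow> Pos (In y) \<notin> S)
    | I2 x \<Rightarrow> Pos (In x) \<notin> S \<and> (\<forall>y. (y, x) \<in> R \<longrightarrow> Pos (Out y) \<in> S))"
  using assms attacks by (cases b) (auto simp: all_present_def)

end

declare base_cond.simps [simp del]

section \<open>Reaching a complete labelling\<close>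

locale labelled_framework = attack_framework A R
  for A :: "'a set" and R :: "('a \<times> 'a) set" +
  fixes L :: "'a \<rightharpoonup> label"
  assumes complete: "complete_labelling A R L"
begin

lemma in_iff: "x \<in> A \<Longrightarrow> L x = Some IN \<longleftrightarrow> (\<forall>y. (y, x) \<in> R \<longrightarrow> L y = Some OUT)"
  and out_iff: "x \<in> A \<Longrightarrow> L x = Some OUT \<longleftrightarrow> (\<exists>y. (y, x) \<in> R \<and> L y = Some IN)"
  and labelled_iff: "x \<in> A \<longleftrightarrow> L x \<noteq> None"
  using complete by (auto simp: complete_labelling_def)

section \<open>The invariant of the exogenous phases\<close>

definition ins :: "'a set" where
  "ins = {x \<in> A. L x = Some IN}"

text \<open>This is the invariant of the exogenous phases: it forces each of them to only add fluents \<open>i\<close>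
  and \<open>o\<close> that agree with \<open>L\<close>. The arguments in \<open>K\<close> hold \<open>i\<close> without support from their attackers being
  out, and keep it because \<open>l\<close> delays their updates. The invariant is used with \<open>K = {}\<close> after all arguments
  have been enunciated and with \<open>K = ins\<close> after the second rank.\<close>

definition below :: "'a set \<Rightarrow> 'a state \<Rightarrow> bool" where
  "below K S \<longleftrightarrow> all_present S \<and> (\<forall>x\<in>A.
     (x \<in> K \<longrightarrow> Pos (In x) \<in> S \<and> Pos (Last x) \<in> S) \<and>
     (Pos (In x) \<in> S \<longrightarrow> L x = Some IN \<and> (x \<in> K \<or> (\<forall>y. (y, x) \<in> R \<longrightarrow> Pos (Out y) \<in> S))) \<and>
     (Pos (Out x) \<in> S \<longrightarrow> L x = Some OUT \<and> (\<exists>y. (y, x) \<in> R \<and> Pos (In y) \<in> S)) \<and>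
     (Pos (Last x) \<in> S \<longrightarrow> Pos (In x) \<in> S \<and> (x \<in> K \<or> (\<forall>y. (y, x) \<notin> R))))"

text \<open>Arguments labelled IN do not attack each other, so this is admissibility of
  \<open>K\<close>. It ensures that an attack delayed by \<open>l\<close> on a member of
  \<open>K\<close> always meets a counterattack.\<close>

definition self_defending :: "'a set \<Rightarrow> bool" where
  "self_defending K \<longleftrightarrow> K \<subseteq> ins \<and> (\<forall>x\<in>K. \<forall>y. (y, x) \<in> R \<longrightarrow> (\<exists>z\<in>K. (z, y) \<in> R))"

lemma self_defending_empty: "self_defending {}"
  by (simp add: self_defending_def)

lemma self_defending_ins: "self_defending ins"
  unfolding self_defending_def
proof (intro conjI ballI allI impI)
  fix x y assume "x \<in> ins" "(y, x) \<in> R"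
  then have "L y = Some OUT" "y \<in> A"
    using in_iff[of x] attacks by (auto simp: ins_def)
  then obtain z where "(z, y) \<in> R" "L z = Some IN"
    using out_iff[of y] by blast
  then show "\<exists>z\<in>ins. (z, y) \<in> R"
    using attacks by (auto simp: ins_def)
qed simp

lemma belowD:
  assumes "below K S"
  shows "all_present S"
    and "x \<in> A \<Longrightarrow> x \<in> K \<Longrightarrow> Pos (In x) \<in> S \<and> Pos (Last x) \<in> S"
    and "x \<in> A \<Longrightarrow> Pos (In x) \<in> S \<Longrightarrow> L x = Some IN"
    and "x \<in> A \<Longrightarrow> Pos (In x) \<in> S \<Longrightarrow> x \<notin> K \<Longrightarrow> (y, x) \<in> R \<Longrightarrow> Pos (Out y) \<in> S"
    and "x \<in> A \<Longrightarrow> Pos (Out x) \<in> S \<Longrightarrow> L x = Some OUT"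
    and "x \<in> A \<Longrightarrow> Pos (Out x) \<in> S \<Longrightarrow> \<exists>y. (y, x) \<in> R \<and> Pos (In y) \<in> S"
    and "x \<in> A \<Longrightarrow> Pos (Last x) \<in> S \<Longrightarrow> Pos (In x) \<in> S"
    and "x \<in> A \<Longrightarrow> Pos (Last x) \<in> S \<Longrightarrow> x \<notin> K \<Longrightarrow> (y, x) \<notin> R"
  using assms unfolding below_def by blast+

text \<open>The invariant contradicts the trigger of \<open>I1\<close> and of the f-version of
  \<open>Delta1\<close>. Holders of \<open>l\<close> are in, hence labelled IN, which leaves
  \<open>Delta1\<close> on a member of \<open>K\<close> as the only possible l-event; a defender in
  \<open>K\<close> then triggers an f-event of higher priority.\<close>

lemma below_top_triggered:
  assumes S: "below K S" and K: "self_defending K" and e: "e \<in> top_triggered \<kappa> S"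
  shows "(\<exists>y x. e = Exo Vf (Delta2 y x) \<and> (y, x) \<in> R \<and> Pos (In y) \<in> S \<and> Pos (Out x) \<notin> S) \<or>
    (\<exists>x. e = Exo Vf (I2 x) \<and> x \<in> A \<and> Pos (In x) \<notin> S \<and> (\<forall>y. (y, x) \<in> R \<longrightarrow> Pos (Out y) \<in> S))"
proof -
  note D = belowD[OF S] and cond = all_present_base_cond[OF belowD(1)[OF S]]
  from e obtain v b where eb: "e = Exo v b" "b \<in> base_events A" "S \<Turnstile> base_cond A b"
    and last: "Pos (Last (target b)) \<in> S \<longleftrightarrow> v = Vl"
    by (auto simp: top_triggered_def triggered_iff)
  note c = eb(3)[unfolded cond[OF eb(2)]]
  show ?thesis
  proof (cases v)
    case Vf
    show ?thesis
    proof (cases b)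
      case (Delta1 y x)
      then show ?thesis using c last Vf D(2,4)[of x] eb(2) by auto
    next
      case (I1 x)
      then show ?thesis using c D(6)[of x] eb(2) by auto
    qed (use c eb Vf in auto)
  next
    case Vl
    have False
    proof (cases b)
      case (Delta1 y x)
      then have yx: "y \<in> A" "x \<in> A" "(y, x) \<in> R" "Pos (Out y) \<notin> S" "Pos (Last x) \<in> S"
        using c eb(2) last Vl by auto
      then have "x \<in> K" using D(8)[of x] by blast
      then obtain z where z: "z \<in> K" "(z, y) \<in> R"
        using K yx(3) unfolding self_defending_def by blast
      then have "z \<in> A" "Pos (In z) \<in> S" "L z = Some IN"
        using D(2)[of z] D(3)[of z] attacks by auto
      then have "L y = Some OUT" using out_iff[of y] yx(1) z(2) by blast
      \<comment> \<open>Under the invariant \<open>l\<close> implies \<open>i\<close>, which an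
        argument labelled OUT lacks. So the counterattack on \<open>y\<close> is an f-event.\<close>
      then have "Pos (Last y) \<notin> S" using D(3,7)[of y] yx(1) by auto
      then have "Exo Vf (Delta2 z y) \<in> triggered \<kappa> S"
        using yx z \<open>z \<in> A\<close> \<open>Pos (In z) \<in> S\<close> by (simp add: triggered_Exo_iff cond)
      moreover have "(Exo Vf (Delta2 z y), e) \<in> Prio \<kappa>"
        using eb Vl yx \<open>z \<in> A\<close> by (simp add: mod_prio_simps)
      ultimately show False using e by (auto simp: top_triggered_def)
    next
      case (Delta2 y x)
      then have "y \<in> A" "x \<in> A" "(y, x) \<in> R" "Pos (In y) \<in> S" "Pos (In x) \<in> S"
        using c eb(2) last Vl D(7) by auto
      then show False using D(3)[of x] D(3)[of y] in_iff[of x] by auto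
    next
      case (I1 x)
      then show False using c eb(2) last Vl D(3,5,7)[of x] by auto
    next
      case (I2 x)
      then show False using c eb(2) last Vl D(7)[of x] by auto
    qed
    then show ?thesis ..
  qed
qed

text \<open>The events that fire only add \<open>i\<close> or \<open>o\<close>, and the completeness
  equivalences make each addition agree with \<open>L\<close>. The strict growth in the last claim
  gives termination.\<close>

lemma below_successor:
  assumes S: "below K S" and K: "self_defending K"
  defines "E \<equiv> top_triggered \<kappa> S"
  defines "S' \<equiv> successor \<kappa> S E"
  shows "below K S'"
    and "{f \<in> fluents A. Pos f \<in> S} \<subseteq> {f. Pos f \<in> S'}"
    and "E \<noteq> {} \<Longrightarrow> \<exists>f\<in>fluents A. Pos f \<notin> S \<and> Pos f \<in> S'"
proof -
  note D = belowD[OF S] and E = below_top_triggered[OF S K, folded E_def]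
  have st: "is_state (fluents A) S" using D(1) by (simp add: all_present_def)
  have "E \<subseteq> Exogenous \<kappa>"
    by (auto simp: E_def top_triggered_def triggered_def)
  then have lit: "Eff \<kappa> e \<subseteq> literals (Fluents \<kappa>)" if "e \<in> E" for e
    using that by (intro mod_eff_literals) auto
  \<comment> \<open>Only l-versions remove \<open>l\<close>, and \<open>Delta2\<close> and
    \<open>I2\<close> have positive base effects.\<close>
  have noneg: "Neg f \<notin> Eff \<kappa> e" if "e \<in> E" for e f
    using E[OF that] by auto
  note sc = successor_consistent[of \<kappa> S E, OF _ lit noneg, folded S'_def]
  have pos: "Pos f \<in> S' \<longleftrightarrow> Pos f \<in> S \<or> (\<exists>e\<in>E. Pos f \<in> mod_eff e)" for f
    using sc(2) noneg st by auto
  have eff: "Pos f \<in> S' \<Longrightarrow> Pos f \<in> S \<or>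
      (\<exists>y x. f = Out x \<and> (y, x) \<in> R \<and> Pos (In y) \<in> S) \<or>
      (\<exists>x. f = In x \<and> x \<in> A \<and> (\<forall>y. (y, x) \<in> R \<longrightarrow> Pos (Out y) \<in> S))" for f
    unfolding pos using E by fastforce
  have mono: "Pos f \<in> S \<Longrightarrow> Pos f \<in> S'" for f
    by (simp add: pos)
  then show "{f \<in> fluents A. Pos f \<in> S} \<subseteq> {f. Pos f \<in> S'}" by blast
  show "\<exists>f\<in>fluents A. Pos f \<notin> S \<and> Pos f \<in> S'" if "E \<noteq> {}"
  proof -
    from that obtain e where "e \<in> E" by blast
    from E[OF this] show ?thesis
    proof (elim disjE exE conjE)
      fix y x assume "e = Exo Vf (Delta2 y x)" "(y, x) \<in> R" "Pos (Out x) \<notin> S"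
      then show ?thesis
        using \<open>e \<in> E\<close> attacks
        by (intro bexI[of _ "Out x"]) (auto simp: pos fluents_def intro: bexI[of _ e])
    next
      fix x assume "e = Exo Vf (I2 x)" "x \<in> A" "Pos (In x) \<notin> S"
      then show ?thesis
        using \<open>e \<in> E\<close>
        by (intro bexI[of _ "In x"]) (auto simp: pos fluents_def intro: bexI[of _ e])
    qed
  qed
  have same: "Pos (Last x) \<in> S' \<longleftrightarrow> Pos (Last x) \<in> S" "Pos (CanAttack y x) \<in> S' \<longleftrightarrow> Pos (CanAttack y x) \<in> S"
    for y x using mono eff by blast+
  have "all_present S'"
    using D(1) sc(1) mono st by (simp add: all_present_def same)
  moreover have "L x = Some IN \<and> (x \<in> K \<or> (\<forall>y. (y, x) \<in> R \<longrightarrow> Pos (Out y) \<in> S'))"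
    if "x \<in> A" "Pos (In x) \<in> S'" for x
  proof (cases "Pos (In x) \<in> S")
    case True
    then show ?thesis using D(3,4)[OF that(1)] mono by blast
  next
    case False
    then have *: "\<forall>y. (y, x) \<in> R \<longrightarrow> Pos (Out y) \<in> S"
      using eff[OF that(2)] by auto
    then have "\<forall>y. (y, x) \<in> R \<longrightarrow> L y = Some OUT"
      using D(5) attacks by blast
    then show ?thesis using * in_iff[OF that(1)] mono by blast
  qed
  moreover have "L x = Some OUT \<and> (\<exists>y. (y, x) \<in> R \<and> Pos (In y) \<in> S')"
    if "x \<in> A" "Pos (Out x) \<in> S'" for x
  proof (cases "Pos (Out x) \<in> S")
    case True
    then show ?thesis using D(5,6)[OF that(1)] mono by blast
  next
    case False
    then have "\<exists>y. (y, x) \<in> R \<and> Pos (In y) \<in> S"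
      using eff[OF that(2)] by auto
    then obtain y where "(y, x) \<in> R" "Pos (In y) \<in> S"
      by blast
    then show ?thesis using D(3)[of y] out_iff[OF that(1)] attacks mono by blast
  qed
  ultimately show "below K S'"
    using D(2,7,8) mono unfolding below_def same by blast
qed

text \<open>The number of false fluents decreases with each exogenous step. Quantifying over
  \<open>Bs\<close> and \<open>U\<close> allows the phase to precede any remaining agenda.\<close>

lemma below_settles:
  assumes "below K S" "self_defending K"
  shows "\<exists>T. below K T \<and> triggered \<kappa> T = {} \<and> (\<forall>Bs U. outcome \<kappa> T Bs U \<longrightarrow> outcome \<kappa> S Bs U)"
  using assms(1)
proof (induction "card {f \<in> fluents A. Pos f \<notin> S}" arbitrary: S rule: less_induct)
  case less
  show ?case
  proof (cases "triggered \<kappa> S = {}")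
    case True
    then show ?thesis using less.prems by blast
  next
    case False
    let ?S' = "successor \<kappa> S (top_triggered \<kappa> S)"
    note step = below_successor[OF less.prems assms(2)]
    have "{f \<in> fluents A. Pos f \<notin> ?S'} \<subset> {f \<in> fluents A. Pos f \<notin> S}"
      using step(2) step(3)[OF top_triggered_nonempty[OF False]] by blast
    then have "card {f \<in> fluents A. Pos f \<notin> ?S'} < card {f \<in> fluents A. Pos f \<notin> S}"
      using finite_fluents[OF finite_args] by (intro psubset_card_mono) auto
    from less.hyps[OF this step(1)] obtain T where
      "below K T" "triggered \<kappa> T = {}" "\<forall>Bs U. outcome \<kappa> T Bs U \<longrightarrow> outcome \<kappa> ?S' Bs U"
      by blast
    moreover have "is_state (Fluents \<kappa>) S"
      using less.prems by (simp add: below_def all_present_def)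
    ultimately show ?thesis using False outcome_exo by blast
  qed
qed

text \<open>All arguments labelled IN are in already. An argument labelled OUT that is not out would
  have an attacker that is in and would lack \<open>l\<close>, so the f-version of
  \<open>Delta2\<close> would be triggered.\<close>

lemma below_ins_settled:
  assumes S: "below ins S" and settled: "triggered \<kappa> S = {}" and x: "x \<in> A"
  shows "Pos (In x) \<in> S \<longleftrightarrow> L x = Some IN" and "Pos (Out x) \<in> S \<longleftrightarrow> L x = Some OUT"
proof -
  note D = belowD[OF S] and cond = all_present_base_cond[OF belowD(1)[OF S]]
  have in_S: "Pos (In x) \<in> S \<longleftrightarrow> L x = Some IN" if "x \<in> A" for x
    using D(2,3)[OF that] that by (auto simp: ins_def)
  then show "Pos (In x) \<in> S \<longleftrightarrow> L x = Some IN"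
    using x .
  have "Pos (Out x) \<in> S" if "L x = Some OUT"
  proof (rule ccontr)
    assume "Pos (Out x) \<notin> S"
    moreover obtain y where "(y, x) \<in> R" "L y = Some IN"
      using out_iff[OF x] \<open>L x = Some OUT\<close> by blast
    moreover have "Pos (Last x) \<notin> S"
      using D(7)[OF x] in_S[OF x] \<open>L x = Some OUT\<close> by auto
    ultimately have "Exo Vf (Delta2 y x) \<in> triggered \<kappa> S"
      using attacks in_S[of y] by (auto simp: triggered_Exo_iff cond)
    with settled show False by blast
  qed
  with D(5)[OF x] show "Pos (Out x) \<in> S \<longleftrightarrow> L x = Some OUT" by blast
qed

text \<open>Once \<open>i\<close> and \<open>o\<close> coincide with the labels IN and OUT, the
  conditions of \<open>argumentative\<close> are the completeness equivalences of
  \<open>L\<close>.\<close>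

lemma below_ins_final:
  assumes S: "below ins S" and settled: "triggered \<kappa> S = {}"
  shows "argumentative A S" and "assoc_labelling A S = L"
proof -
  note io = below_ins_settled[OF S settled]
  have st: "is_state (fluents A) S" and pr: "\<And>x. x \<in> A \<Longrightarrow> Pos (Present x) \<in> S"
    and ca: "\<And>y x. y \<in> A \<Longrightarrow> x \<in> A \<Longrightarrow> Pos (CanAttack y x) \<in> S \<longleftrightarrow> (y, x) \<in> R"
    using belowD(1)[OF S] by (auto simp: all_present_def)
  have "(\<forall>y\<in>A. (y, x) \<in> R \<longrightarrow> L y = Some OUT) \<longleftrightarrow> L x = Some IN" if "x \<in> A" for x
    using in_iff[OF that] attacks by blast
  moreover have "(\<exists>y\<in>A. (y, x) \<in> R \<and> L y = Some IN) \<longleftrightarrow> L x = Some OUT" if "x \<in> A" for x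
    using out_iff[OF that] attacks by blast
  moreover have "L y \<noteq> Some IN \<and> L y = Some OUT \<longleftrightarrow> L y = Some OUT"
    "L y = Some IN \<and> L y \<noteq> Some OUT \<longleftrightarrow> L y = Some IN" for y
    by auto
  ultimately show "argumentative A S"
    using st by (simp add: argumentative_def pr ca io disj_not2 cong: ball_cong bex_cong)
  show "assoc_labelling A S = L"
  proof
    fix x
    show "assoc_labelling A S x = L x"
    proof (cases "x \<in> A")
      case True
      then obtain v where "L x = Some v" using labelled_iff by auto
      then show ?thesis using True by (cases v) (auto simp: assoc_labelling_def pr io)
    next
      case False
      then show ?thesis using labelled_iff by (auto simp: assoc_labelling_def)
    qed
  qed
qed

text \<open>After the joint enunciation all arguments are in, not out, and hold \<open>l\<close>, so
  every attack triggers the l-versions of \<open>Delta1\<close> and \<open>Delta2\<close>.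
  \<open>Delta1\<close> has priority and strips all attacked arguments of \<open>i\<close> and
  \<open>l\<close>. The unattacked ones stay in, and they are IN in every complete
  labelling.\<close>

lemma enunciate_all_below:
  "\<exists>T. below {} T \<and> (\<forall>Bs U. outcome \<kappa> T Bs U \<longrightarrow>
     outcome \<kappa> (successor \<kappa> (mod_init A R) (Enunciate ` A)) Bs U)"
proof -
  define S where "S = successor \<kappa> (mod_init A R) (Enunciate ` A)"
  note enun = enunciate_successor[OF is_state_init subset_refl, folded S_def]
  have S: "all_present S" "\<And>x. x \<in> A \<Longrightarrow> Pos (In x) \<in> S \<and> Pos (Last x) \<in> S"
    "\<And>x. Pos (Out x) \<notin> S"
    by (auto simp: all_present_def enun) (auto simp: mod_init_def)
  note cond = all_present_base_cond[OF S(1)]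
  have trig: "triggered \<kappa> S =
      {Exo Vl (Delta1 y x) | y x. (y, x) \<in> R} \<union> {Exo Vl (Delta2 y x) | y x. (y, x) \<in> R}"
  proof (intro set_eqI iffI)
    fix e assume "e \<in> triggered \<kappa> S"
    then obtain v b where eb: "e = Exo v b" "b \<in> base_events A" "S \<Turnstile> base_cond A b"
      and last: "Pos (Last (target b)) \<in> S \<longleftrightarrow> v = Vl"
      by (auto simp: triggered_iff)
    show "e \<in> {Exo Vl (Delta1 y x) | y x. (y, x) \<in> R} \<union> {Exo Vl (Delta2 y x) | y x. (y, x) \<in> R}"
      using eb(1,2) last eb(3)[unfolded cond[OF eb(2)]] S(2,3) by (cases b) auto
  qed (use S attacks in \<open>auto simp: triggered_Exo_iff cond\<close>)
  show ?thesis
  \<comment> \<open>Without attacks nothing is triggered and there is no exogenous step to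
    take.\<close>
  proof (cases "R = {}")
    case True
    then have "below {} S"
      using S in_iff unfolding below_def by blast
    then show ?thesis by (auto simp: S_def)
  next
    case False
    define E where "E = {Exo Vl (Delta1 y x) | y x. (y, x) \<in> R}"
    have top: "top_triggered \<kappa> S = E"
    proof -
      have "(Exo Vl (Delta1 y x), Exo Vl (Delta2 y x)) \<in> mod_prio A" if "(y, x) \<in> R" for y x
        using that attacks by (auto simp: mod_prio_simps)
      moreover have "(e', Exo Vl (Delta1 y x)) \<notin> mod_prio A" if "e' \<in> triggered \<kappa> S" for e' y x
        using that by (auto simp: trig mod_prio_simps)
      ultimately show ?thesis
        unfolding top_triggered_def trig E_def context_sel by blast
    qed
    define S' where "S' = successor \<kappa> S E"
    have lit: "Eff \<kappa> e \<subseteq> literals (Fluents \<kappa>)" if "e \<in> E" for e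
      using that attacks by (intro mod_eff_literals) (auto simp: E_def)
    have con: "Neg f \<notin> Eff \<kappa> e'" if "e \<in> E" "e' \<in> E" "Pos f \<in> Eff \<kappa> e" for e e' f
      using that by (auto simp: E_def)
    have st: "is_state (Fluents \<kappa>) S"
      using S(1) by (simp add: all_present_def)
    note sc = successor_consistent[of \<kappa> S E, OF st lit con, folded S'_def]
    have pos: "Pos f \<in> S' \<longleftrightarrow> Pos f \<in> S \<and> (\<forall>y x. (y, x) \<in> R \<longrightarrow> f \<noteq> In x \<and> f \<noteq> Last x)" for f
    proof -
      have "(\<forall>e\<in>E. Q e) \<longleftrightarrow> (\<forall>y x. (y, x) \<in> R \<longrightarrow> Q (Exo Vl (Delta1 y x)))" for Q
        by (auto simp: E_def)
      then show ?thesis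
        by (subst sc(2)) (auto simp: E_def)
    qed
    have "below {} S'"
      using S sc(1) in_iff attacks unfolding below_def all_present_def pos by auto
    moreover have "triggered \<kappa> S \<noteq> {}"
      using False trig by auto
    ultimately show ?thesis
      using outcome_exo[OF st, unfolded top] unfolding S_def[symmetric] S'_def by blast
  qed
qed

text \<open>Passes from \<open>K = {}\<close> to \<open>K = ins\<close>: membership in
  \<open>K\<close> replaces the missing support of the newly enunciated arguments. No
  \<open>o\<close> is erased, since arguments that are out are labelled OUT.\<close>

lemma enunciate_ins_below:
  assumes S: "below {} S"
  shows "below ins (successor \<kappa> S (Enunciate ` ins))"
proof -
  note D = belowD[OF S]
  have "is_state (fluents A) S" "ins \<subseteq> A"
    using D(1) by (auto simp: all_present_def ins_def)
  note enun = enunciate_successor[OF this]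
  let ?S' = "successor \<kappa> S (Enunciate ` ins)"
  have "all_present ?S'"
    using D(1) by (auto simp: all_present_def enun)
  moreover have "x \<in> ins \<longleftrightarrow> L x = Some IN" if "x \<in> A" for x
    using that by (simp add: ins_def)
  ultimately show ?thesis
    using D(3,5,6,7,8) unfolding below_def enun by (auto; metis)
qed

section \<open>The sequence and its unique path\<close>

definition enunciations :: "('a event \<times> nat) set" where
  "enunciations = Enunciate ` A \<times> {0} \<union> Enunciate ` ins \<times> {1}"

lemma action_sequence_enunciations: "action_sequence \<kappa> enunciations"
  using finite_args by (auto simp: action_sequence_def enunciations_def ins_def)

text \<open>A rank without actions does not occur at all, which matches the nonemptiness demanded by
  \<open>act\<close>.\<close>

lemma rank_actions_enunciations:
  "rank_actions enunciations = (if A = {} then [] else [Enunciate ` A]) @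
     (if ins = {} then [] else [Enunciate ` ins])"
proof -
  have "snd ` enunciations = (if A = {} then {} else {0}) \<union> (if ins = {} then {} else {1})"
    by (auto simp: enunciations_def image_Un)
  moreover have "A = {} \<Longrightarrow> ins = {}" unfolding ins_def by blast
  moreover have "{a. (a, 0) \<in> enunciations} = Enunciate ` A"
    "{a. (a, Suc 0) \<in> enunciations} = Enunciate ` ins"
    by (auto simp: enunciations_def)
  ultimately show ?thesis
    by (auto simp: rank_actions_def)
qed

lemma enunciations_outcome:
  "\<exists>T. below ins T \<and> triggered \<kappa> T = {} \<and>
     outcome \<kappa> (mod_init A R) (rank_actions enunciations) T"
proof -
  \<comment> \<open>The part common to empty and nonempty \<open>A\<close>: settle, repeat the
    arguments labelled IN, settle again.\<close>
  have settle: "\<exists>T. below ins T \<and> triggered \<kappa> T = {} \<and>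
     outcome \<kappa> S (if ins = {} then [] else [Enunciate ` ins]) T" if "below {} S" for S
  proof -
    from below_settles[OF that self_defending_empty] obtain S1 where
      S1: "below {} S1" "triggered \<kappa> S1 = {}" "\<And>Bs U. outcome \<kappa> S1 Bs U \<Longrightarrow> outcome \<kappa> S Bs U"
      by blast
    show ?thesis
    proof (cases "ins = {}")
      case True
      \<comment> \<open>With no argument labelled IN, \<open>below {}\<close> is already
        \<open>below ins\<close>, and the first settled state is final.\<close>
      then show ?thesis
        using S1(1,2) S1(3)[OF outcome_stop[OF S1(2)]] by (intro exI[of _ S1]) simp
    next
      case False
      let ?S2 = "successor \<kappa> S1 (Enunciate ` ins)"
      from below_settles[OF enunciate_ins_below[OF S1(1)] self_defending_ins] obtain T where
        T: "below ins T" "triggered \<kappa> T = {}" "\<And>Bs U. outcome \<kappa> T Bs U \<Longrightarrow> outcome \<kappa> ?S2 Bs U"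
        by blast
      have "outcome \<kappa> S1 [Enunciate ` ins] T"
      proof (rule outcome_act)
        show "is_state (Fluents \<kappa>) S1"
          using S1(1) by (simp add: below_def all_present_def)
        show "Enunciate ` ins \<subseteq> Actions \<kappa>"
          by (auto simp: ins_def)
        show "outcome \<kappa> ?S2 [] T"
          using T(3)[OF outcome_stop[OF T(2)]] .
      qed (use S1(2) False in auto)
      with S1(3) T(1,2) False show ?thesis
        by (intro exI[of _ T]) simp
    qed
  qed
  show ?thesis
  proof (cases "A = {}")
    case True
    \<comment> \<open>The invariant holds vacuously, and no enunciation precedes it.\<close>
    then have "below {} (mod_init A R)"
      using is_state_init unfolding below_def all_present_def by blast
    from settle[OF this] show ?thesis
      unfolding rank_actions_enunciations if_P[OF True] append_Nil .
  next
    case False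
    from enunciate_all_below obtain S where S: "below {} S"
      "\<And>Bs U. outcome \<kappa> S Bs U \<Longrightarrow> outcome \<kappa> (successor \<kappa> (mod_init A R) (Enunciate ` A)) Bs U"
      by blast
    from settle[OF S(1)] obtain T where T: "below ins T" "triggered \<kappa> T = {}"
      "outcome \<kappa> S (if ins = {} then [] else [Enunciate ` ins]) T"
      by blast
    have "outcome \<kappa> (mod_init A R) (rank_actions enunciations) T"
      unfolding rank_actions_enunciations using False S(2)[OF T(3)]
      by (simp add: outcome_act is_state_init init_not_triggered)
    with T show ?thesis by blast
  qed
qed

text \<open>By \<open>run_unique\<close> the run found is the only one, so what holds of its last
  state holds for every valid path.\<close>

lemma enunciations_work:
  "(\<exists>!P. valid_path_wrt (enunciations, \<kappa>) P) \<and>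
   (\<forall>Ss Es. valid_path_wrt (enunciations, \<kappa>) (Ss, Es) \<longrightarrow>
      argumentative A (last Ss) \<and> assoc_labelling A (last Ss) = L)"
proof -
  have "finite enunciations"
    using action_sequence_enunciations by (simp add: action_sequence_def)
  note valid = valid_path_wrt_iff_run[OF this]
  from enunciations_outcome obtain Ss Es where
    *: "run \<kappa> (Init \<kappa>) (rank_actions enunciations) Ss Es"
    and last: "below ins (last Ss)" "triggered \<kappa> (last Ss) = {}"
    by (auto simp: outcome_def)
  have "valid_path_wrt (enunciations, \<kappa>) P \<longleftrightarrow> P = (Ss, Es)" for P
    using * run_unique[OF *] by (cases P) (metis prod.inject valid)
  then show ?thesis
    using below_ins_final[OF last] by auto
qed

end

theorem theorem3:
  fixes A :: "'a set" and R :: "('a \<times> 'a) set" and L :: "'a \<rightharpoonup> label"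
  assumes "finite A" and "R \<subseteq> A \<times> A"
    and "complete_labelling A R L"
  shows "\<exists>\<sigma>. action_sequence (modified_context A R) \<sigma> \<and>
    (\<exists>!P. valid_path_wrt (\<sigma>, modified_context A R) P) \<and>
    (\<forall>Ss Es. valid_path_wrt (\<sigma>, modified_context A R) (Ss, Es) \<longrightarrow>
       argumentative A (last Ss) \<and> assoc_labelling A (last Ss) = L)"
proof -
  interpret labelled_framework A R L
    using assms by unfold_locales
  show ?thesis
    using action_sequence_enunciations enunciations_work by blast
qed

end
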